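(* Let $D=(E,\mathcal{F})$ be a binary delta-matroid. If the set $\{w(D*A): A\subseteq E\}$ contains two consecutive integers $k$ and $k+1$, then every integer $m$ with $k+2\le m\le w_M(D)$ belongs to $\{w(D*A): A\subseteq E\}$.
   Context: A set system is a pair $D=(E,\mathcal{F})$ with $E$ finite and $\mathcal{F}$ a collection of subsets of $E$. A delta-matroid is a set system with $\mathcal{F}\neq\emptyset$ such that for all $X,Y\in\mathcal{F}$ and $u\in X\Delta Y$ there is $v\in X\Delta Y$ (possibly $v=u$) with $X\Delta\{u,v\}\in\mathcal{F}$ ($\Delta$ = symmetric difference). The twist by $A\subseteq E$ is $D*A=(E,\{A\Delta X: X\in\mathcal{F}\})$. For a symmetric matrix $C$ over $\mathrm{GF}(2)$ indexed by $E$, $D(C)=(E,\{A\subseteq E: C[A]\text{ non-singular}\})$, with $C[A]$ the principal submatrix on $A$ and $C[\emptyset]$ non-singular by convention; a delta-matroid is binary if some twist of it is isomorphic to some $D(C)$. The width is $w(D)=\max\{|F|:F\in\mathcal{F}\}-\min\{|F|:F\in\mathcal{F}\}$, and the maximum twist width is $w_M(D)=\max\{w(D*A):A\subseteq E\}$. *)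

theory Defs
  imports Main "HOL-Library.Z2" "HOL-Combinatorics.Permutations"
begin

definition symdiff :: "'a set \<Rightarrow> 'a set \<Rightarrow> 'a set" (infixl "\<triangle>" 70) where
  "X \<triangle> Y = (X - Y) \<union> (Y - X)"

definition set_system :: "'a set \<Rightarrow> 'a set set \<Rightarrow> bool" where
  "set_system E F \<longleftrightarrow> finite E \<and> (\<forall>X\<in>F. X \<subseteq> E)"

definition delta_matroid :: "'a set \<Rightarrow> 'a set set \<Rightarrow> bool" where
  "delta_matroid E F \<longleftrightarrow> set_system E F \<and> F \<noteq> {} \<and>
     (\<forall>X\<in>F. \<forall>Y\<in>F. \<forall>u\<in>X \<triangle> Y. \<exists>v\<in>X \<triangle> Y. X \<triangle> {u, v} \<in> F)"

definition twist :: "'a set set \<Rightarrow> 'a set \<Rightarrow> 'a set set" where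
  "twist F A = (\<lambda>X. A \<triangle> X) ` F"

text \<open>Determinant over GF(2) of the principal submatrix of C on A (Leibniz formula);
  the empty submatrix has determinant 1.\<close>
definition det_on :: "('a \<Rightarrow> 'a \<Rightarrow> bit) \<Rightarrow> 'a set \<Rightarrow> bit" where
  "det_on C A = (\<Sum>p\<in>{p. p permutes A}. of_int (sign p) * (\<Prod>i\<in>A. C i (p i)))"

definition symmetric_on :: "'a set \<Rightarrow> ('a \<Rightarrow> 'a \<Rightarrow> bit) \<Rightarrow> bool" where
  "symmetric_on E C \<longleftrightarrow> (\<forall>i\<in>E. \<forall>j\<in>E. C i j = C j i)"

definition DC :: "'a set \<Rightarrow> ('a \<Rightarrow> 'a \<Rightarrow> bit) \<Rightarrow> 'a set set" where
  "DC E C = {A. A \<subseteq> E \<and> det_on C A \<noteq> 0}"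

definition iso_set_system :: "'a set \<Rightarrow> 'a set set \<Rightarrow> 'b set \<Rightarrow> 'b set set \<Rightarrow> bool" where
  "iso_set_system E F E' F' \<longleftrightarrow>
     (\<exists>f. bij_betw f E E' \<and> (\<lambda>X. f ` X) ` F = F')"

text \<open>Binary: some twist is isomorphic to D(C) for a symmetric GF(2) matrix C
  (indexed, without loss of generality up to relabelling, by a set of the same type).\<close>
definition binary_dm :: "'a set \<Rightarrow> 'a set set \<Rightarrow> bool" where
  "binary_dm E F \<longleftrightarrow>
     (\<exists>A\<subseteq>E. \<exists>(E'::'a set) C. symmetric_on E' C \<and> iso_set_system E (twist F A) E' (DC E' C))"

definition width :: "'a set set \<Rightarrow> nat" where
  "width F = Max (card ` F) - Min (card ` F)"

definition twist_widths :: "'a set \<Rightarrow> 'a set set \<Rightarrow> nat set" where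
  "twist_widths E F = {width (twist F A) | A. A \<subseteq> E}"

definition max_twist_width :: "'a set \<Rightarrow> 'a set set \<Rightarrow> nat" where
  "max_twist_width E F = Max (twist_widths E F)"

end

theory Submission
  imports Defs "Jordan_Normal_Form.Determinant"
begin

text \<open>
  Writing \<open>d(X)\<close> for the distance from \<open>X\<close> to the nearest feasible set, the twist by \<open>A\<close> has width
  \<open>|E| - d(A) - d(E - A)\<close>. In a binary delta-matroid, if \<open>F\<close> and \<open>F \<triangle> X\<close> are feasible with \<open>|X|\<close>
  odd, then \<open>F \<triangle> {e}\<close> is feasible for some \<open>e\<close> in \<open>X\<close>: pivoting on \<open>F\<close>, this says that an odd
  alternating matrix over GF(2) is singular. Hence, if moving from \<open>B\<close> along each single element of
  \<open>S\<close> increases \<open>d\<close>, then \<open>d(B \<triangle> S)\<close> and \<open>d(B) + |S|\<close> have the same parity.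
  Suppose \<open>m\<close> is not a twist width, although some \<open>A\<close> has a smaller width of the same parity and some
  set has a larger one. Take \<open>B\<close> of width greater than \<open>m\<close> as close to \<open>A\<close> as possible. A single
  element changes the width by at most 2, so every step from \<open>B\<close> towards \<open>A\<close> lowers it from \<open>m + 1\<close>
  to \<open>m - 1\<close>; by the parity statement \<open>A\<close> and \<open>B\<close> then have widths of equal parity, a contradiction.
\<close>

text \<open>These two simp rules turn field operations on bits into bitwise ones and defeat ring reasoning.\<close>

declare add_bit_eq_xor [simp del] mult_bit_eq_and [simp del]

section \<open>Principal submatrices over GF(2)\<close>

text \<open>Triviality of the kernel, a form of non-singularity suited to direct work with kernel
  vectors. Vectors are functions on the whole type; only their values on \<open>A\<close>
  count.\<close>

definition nonsingular_on :: "('a \<Rightarrow> 'a \<Rightarrow> bit) \<Rightarrow> 'a set \<Rightarrow> bool" where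
  "nonsingular_on C A \<longleftrightarrow>
     (\<forall>v. (\<forall>i\<in>A. (\<Sum>j\<in>A. C i j * v j) = 0) \<longrightarrow> (\<forall>i\<in>A. v i = 0))"

lemma nonsingular_onD:
  "nonsingular_on C A \<Longrightarrow> (\<And>i. i \<in> A \<Longrightarrow> (\<Sum>j\<in>A. C i j * v j) = 0) \<Longrightarrow> i \<in> A \<Longrightarrow> v i = 0"
  unfolding nonsingular_on_def by blast

lemma bit_add_self [simp]: "x + x = (0::bit)"
  by (cases x) simp_all

lemma bit_add_eq_0_iff: "x + y = (0::bit) \<longleftrightarrow> x = y"
  by (cases x; cases y) simp_all

lemma bit_mult_self: "x * x = (x::bit)"
  by (cases x) simp_all

lemma symmetric_onD: "symmetric_on A C \<Longrightarrow> i \<in> A \<Longrightarrow> j \<in> A \<Longrightarrow> C i j = C j i"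
  unfolding symmetric_on_def by blast

lemma symmetric_on_subset: "symmetric_on A C \<Longrightarrow> B \<subseteq> A \<Longrightarrow> symmetric_on B C"
  unfolding symmetric_on_def by blast

lemma sum_bit_one: "finite A \<Longrightarrow> (\<Sum>i\<in>A. 1) = (of_bool (odd (card A)) :: bit)"
  by (induction A rule: finite_induct) auto

section \<open>Determinant versus kernel\<close>

text \<open>Conjugation by \<open>f\<close> is a sign-preserving bijection from the permutations of
  \<open>A\<close> to those of its image. This serves both to index by natural numbers and to
  transport a matrix along an isomorphism.\<close>

lemma det_on_image:
  assumes inj: "inj_on f A" and fin: "finite A"
  shows "det_on C (f ` A) = det_on (\<lambda>i j. C (f i) (f j)) A"
proof -
  have bij: "bij_betw f A (f ` A)"
    using inj by (simp add: bij_betw_def)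
  note bij' = bij_betw_inv_into[OF bij]
  show ?thesis unfolding det_on_def
  proof (rule sum.reindex_bij_witness[where i = "map_permutation A f"
        and j = "map_permutation (f ` A) (inv_into A f)"])
    fix p assume "p \<in> {p. p permutes f ` A}"
    then have p: "p permutes f ` A" by simp
    show inv: "map_permutation A f (map_permutation (f ` A) (inv_into A f) p) = p"
      by (rule map_permutation_compose_inv[OF bij' p]) (auto simp: f_inv_into_f)
    define q where "q = map_permutation (f ` A) (inv_into A f) p"
    show "map_permutation (f ` A) (inv_into A f) p \<in> {p. p permutes A}"
      using map_permutation_permutes[OF bij' p] by simp
    then have q: "q permutes A" by (simp add: q_def)
    have pq: "p = map_permutation A f q" using inv by (simp add: q_def)
    have "(\<Prod>i\<in>f ` A. C i (p i)) = (\<Prod>i\<in>A. C (f i) (p (f i)))"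
      by (simp add: prod.reindex[OF inj])
    also have "\<dots> = (\<Prod>i\<in>A. C (f i) (f (q i)))"
      by (rule prod.cong[OF refl]) (simp add: pq map_permutation_apply[OF inj])
    finally show "of_int (sign (map_permutation (f ` A) (inv_into A f) p)) *
          (\<Prod>i\<in>A. C (f i) (f (map_permutation (f ` A) (inv_into A f) p i))) =
        of_int (sign p) * (\<Prod>i\<in>f ` A. C i (p i))"
      using sign_map_permutation[OF inj q fin] by (simp add: pq[symmetric] q_def[symmetric])
  next
    fix p assume "p \<in> {p. p permutes A}"
    then have p: "p permutes A" by simp
    show "map_permutation A f p \<in> {p. p permutes f ` A}"
      using map_permutation_permutes[OF bij p] by simp
    show "map_permutation (f ` A) (inv_into A f) (map_permutation A f p) = p"
      by (rule map_permutation_compose_inv[OF bij p]) (simp add: inj)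
  qed
qed

text \<open>On an initial segment of the naturals the Leibniz sum is the determinant of a genuine
  matrix, and over a field that vanishes exactly when the kernel is nontrivial.\<close>

lemma det_on_atLeastLessThan_nonzero_iff:
  fixes n :: nat
  shows "det_on C {0..<n} \<noteq> 0 \<longleftrightarrow> nonsingular_on C {0..<n}"
proof -
  define M where "M = mat n n (\<lambda>(i, j). C i j)"
  have M: "M \<in> carrier_mat n n" by (simp add: M_def)
  have "(\<Prod>i = 0..<n. M $$ (i, p i)) = (\<Prod>i = 0..<n. C i (p i))" if "p permutes {0..<n}" for p
    using permutes_in_image[OF that] by (intro prod.cong) (auto simp: M_def)
  then have "det M = det_on C {0..<n}"
    unfolding det_def'[OF M] det_on_def by (intro sum.cong) auto
  moreover have "(\<exists>v. v \<in> carrier_vec n \<and> v \<noteq> 0\<^sub>v n \<and> M *\<^sub>v v = 0\<^sub>v n)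
      \<longleftrightarrow> \<not> nonsingular_on C {0..<n}" (is "?L \<longleftrightarrow> ?R")
  proof
    assume ?L
    then obtain v where v: "v \<in> carrier_vec n" "v \<noteq> 0\<^sub>v n" "M *\<^sub>v v = 0\<^sub>v n" by blast
    from v(1,2) obtain i where i: "i < n" "v $ i \<noteq> 0" by (metis carrier_vecD eq_vecI index_zero_vec)
    have "(\<Sum>j = 0..<n. C k j * v $ j) = 0" if "k < n" for k
    proof -
      have "(M *\<^sub>v v) $ k = (\<Sum>j = 0..<n. C k j * v $ j)"
        using that v(1) by (auto simp: M_def scalar_prod_def)
      then show ?thesis using v(3) that by simp
    qed
    with i show ?R unfolding nonsingular_on_def
      by (intro notI) (drule spec[of _ "\<lambda>j. v $ j"], auto)
  next
    assume ?R
    then obtain v i where v: "\<And>k. k < n \<Longrightarrow> (\<Sum>j = 0..<n. C k j * v j) = 0" "i < n" "v i \<noteq> 0"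
      unfolding nonsingular_on_def Ball_def atLeastLessThan_iff by blast
    have "M *\<^sub>v vec n v = 0\<^sub>v n"
    proof (rule eq_vecI)
      fix k assume "k < dim_vec (0\<^sub>v n :: bit vec)"
      then show "(M *\<^sub>v vec n v) $ k = 0\<^sub>v n $ k"
        using v(1)[of k] by (auto simp: M_def scalar_prod_def)
    qed (simp add: M_def)
    moreover have "vec n v \<noteq> 0\<^sub>v n" using v(2,3) by (metis index_vec index_zero_vec(1))
    ultimately show ?L by (intro exI[of _ "vec n v"]) simp
  qed
  ultimately show ?thesis using det_0_iff_vec_prod_zero_field[OF M] by auto
qed

lemma nonsingular_on_image:
  assumes inj: "inj_on f A"
  shows "nonsingular_on C (f ` A) \<longleftrightarrow> nonsingular_on (\<lambda>i j. C (f i) (f j)) A"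
proof
  assume L: "nonsingular_on C (f ` A)"
  show "nonsingular_on (\<lambda>i j. C (f i) (f j)) A" unfolding nonsingular_on_def
  proof (intro allI impI ballI)
    fix v i assume v: "\<forall>i\<in>A. (\<Sum>j\<in>A. C (f i) (f j) * v j) = 0" and i: "i \<in> A"
    show "v i = 0"
      using nonsingular_onD[OF L, of "\<lambda>k. v (inv_into A f k)" "f i"] v i
      by (auto simp: sum.reindex[OF inj] inv_into_f_f[OF inj])
  qed
next
  assume R: "nonsingular_on (\<lambda>i j. C (f i) (f j)) A"
  show "nonsingular_on C (f ` A)" unfolding nonsingular_on_def
  proof (intro allI impI ballI)
    fix v i assume v: "\<forall>i\<in>f ` A. (\<Sum>j\<in>f ` A. C i j * v j) = 0" and i: "i \<in> f ` A"
    then show "v i = 0"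
      using nonsingular_onD[OF R, of "\<lambda>k. v (f k)"]
      by (auto simp: sum.reindex[OF inj])
  qed
qed

lemma det_on_nonzero_iff:
  assumes "finite A"
  shows "det_on C A \<noteq> 0 \<longleftrightarrow> nonsingular_on C A"
proof -
  obtain h and n :: nat where h: "bij_betw h {0..<n} A"
    using ex_bij_betw_nat_finite[OF assms] by blast
  then have inj: "inj_on h {0..<n}" and A: "h ` {0..<n} = A"
    by (auto simp: bij_betw_def)
  show ?thesis
    using det_on_image[OF inj finite_atLeastLessThan, of C] nonsingular_on_image[OF inj, of C]
      det_on_atLeastLessThan_nonzero_iff[of "\<lambda>i j. C (h i) (h j)" n]
    unfolding A by simp
qed

section \<open>Alternating matrices and symmetric forms over GF(2)\<close>

text \<open>The two members of an orbit {\<open>p\<close>, \<open>g p\<close>} contribute equal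
  bits, which cancel; a fixed point contributes 0.\<close>

lemma sum_bit_involution:
  fixes t :: "'b \<Rightarrow> bit"
  assumes "finite P"
    and "\<And>p. p \<in> P \<Longrightarrow> g p \<in> P" "\<And>p. p \<in> P \<Longrightarrow> g (g p) = p"
    and "\<And>p. p \<in> P \<Longrightarrow> t (g p) = t p"
    and "\<And>p. p \<in> P \<Longrightarrow> g p = p \<Longrightarrow> t p = 0"
  shows "sum t P = 0"
  using assms
proof (induction P rule: finite_psubset_induct)
  case (psubset P)
  show ?case
  proof (cases "P = {}")
    case False
    then obtain p where p: "p \<in> P" by blast
    have "sum t (P - {p, g p}) = 0"
    proof (rule psubset.IH)
      show "P - {p, g p} \<subset> P" using p by blast
      show "g q \<in> P - {p, g p}" if "q \<in> P - {p, g p}" for q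
        using that psubset.prems(1,2) p by (metis DiffD1 DiffD2 DiffI insert_iff singletonD)
    qed (use psubset.prems in auto)
    moreover have "sum t {p, g p} = 0"
      using psubset.prems(3)[OF p] psubset.prems(4)[OF p] by (cases "g p = p") auto
    moreover have "sum t P = sum t (P - {p, g p}) + sum t {p, g p}"
      using p psubset.hyps psubset.prems(1) by (intro sum.subset_diff) auto
    ultimately show ?thesis by simp
  qed simp
qed

lemma det_on_alternating_odd:
  assumes "finite A" "odd (card A)" "symmetric_on A C" "\<And>i. i \<in> A \<Longrightarrow> C i i = 0"
  shows "det_on C A = 0"
  unfolding det_on_def
  \<comment> \<open>The terms of \<open>p\<close> and its inverse cancel; an involution of an odd set has a fixed point.\<close>
proof (rule sum_bit_involution[where g = "inv_into UNIV"])
  fix p assume "p \<in> {p. p permutes A}"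
  then have p: "p permutes A" by simp
  show "inv_into UNIV p \<in> {p. p permutes A}" using permutes_inv[OF p] by simp
  show "inv_into UNIV (inv_into UNIV p) = p" using inv_inv_eq permutes_bij[OF p] by blast
  have "(\<Prod>i\<in>A. C i (inv_into UNIV p i)) = (\<Prod>i\<in>A. C (p i) (inv_into UNIV p (p i)))"
    by (rule prod.reindex_bij_betw[OF permutes_imp_bij[OF p], symmetric])
  also have "\<dots> = (\<Prod>i\<in>A. C i (p i))"
    using assms(3) permutes_in_image[OF p] permutes_inverses(2)[OF p]
    by (intro prod.cong) (auto simp: symmetric_on_def)
  finally show "of_int (sign (inv_into UNIV p)) * (\<Prod>i\<in>A. C i (inv_into UNIV p i)) = of_int (sign p) * (\<Prod>i\<in>A. C i (p i))"
    using permutes_imp_permutation[OF assms(1) p] by (simp add: sign_inverse)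
  assume "inv_into UNIV p = p"
  have "\<exists>i\<in>A. p i = i"
  proof (rule ccontr)
    assume "\<not> (\<exists>i\<in>A. p i = i)"
    then have "(\<Sum>i\<in>A. 1 :: bit) = 0"
      using \<open>inv_into UNIV p = p\<close> permutes_inverses(2)[OF p]
      by (intro sum_bit_involution[where g = p]) (auto simp: assms(1) permutes_in_image[OF p])
    then show False using assms(1,2) by (simp add: sum_bit_one del: sum_constant)
  qed
  then have "(\<Prod>i\<in>A. C i (p i)) = 0"
    using assms(1,4) by (metis prod_zero)
  then show "of_int (sign p) * (\<Prod>i\<in>A. C i (p i)) = 0" by simp
qed (simp add: finite_permutations[OF assms(1)])

text \<open>In characteristic 2 the terms for (i, j) and (j, i) cancel, and each bit is its own
  square. The quadratic form is therefore linear, with the diagonal as coefficients.\<close>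

lemma quadratic_form_eq_diagonal:
  fixes C :: "'a \<Rightarrow> 'a \<Rightarrow> bit"
  assumes "finite A" "symmetric_on A C"
  shows "(\<Sum>i\<in>A. v i * (\<Sum>j\<in>A. C i j * v j)) = (\<Sum>i\<in>A. C i i * v i)"
  using assms
proof (induction A rule: finite_induct)
  case (insert x A)
  have IH: "(\<Sum>i\<in>A. v i * (\<Sum>j\<in>A. C i j * v j)) = (\<Sum>i\<in>A. C i i * v i)"
    using insert.prems by (intro insert.IH) (rule symmetric_on_subset[OF _ subset_insertI])
  have sym: "C i x = C x i" if "i \<in> A" for i
    using symmetric_onD[OF insert.prems] that by blast
  define r where "r = (\<Sum>j\<in>A. C x j * v j)"
  have "(\<Sum>i\<in>A. v i * (C i x * v x)) = (\<Sum>j\<in>A. v x * (C x j * v j))"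
    by (rule sum.cong[OF refl]) (simp only: sym mult_ac)
  then have r: "(\<Sum>i\<in>A. v i * (C i x * v x)) = v x * r"
    by (simp only: r_def sum_distrib_left)
  have "(\<Sum>i\<in>insert x A. v i * (\<Sum>j\<in>insert x A. C i j * v j)) =
      v x * (C x x * v x + r) + ((\<Sum>i\<in>A. v i * (C i x * v x)) + (\<Sum>i\<in>A. v i * (\<Sum>j\<in>A. C i j * v j)))"
    by (simp only: sum.insert[OF insert(1,2)] r_def distrib_left sum.distrib add_ac)
  also have "\<dots> = v x * (C x x * v x + r) + (v x * r + (\<Sum>i\<in>A. C i i * v i))"
    by (simp only: r IH)
  also have "\<dots> = C x x * v x + (\<Sum>i\<in>A. C i i * v i)"
    by (cases "v x"; cases "C x x"; cases r) simp_all
  finally show ?case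
    by (simp only: sum.insert[OF insert(1,2)])
qed simp

lemma bilinear_form_commute:
  fixes C :: "'a \<Rightarrow> 'a \<Rightarrow> bit"
  assumes "symmetric_on A C"
  shows "(\<Sum>i\<in>A. w i * (\<Sum>j\<in>A. C i j * v j)) = (\<Sum>i\<in>A. v i * (\<Sum>j\<in>A. C i j * w j))"
proof -
  have "(\<Sum>i\<in>A. w i * (\<Sum>j\<in>A. C i j * v j)) = (\<Sum>j\<in>A. \<Sum>i\<in>A. w i * (C i j * v j))"
    unfolding sum_distrib_left by (rule sum.swap)
  also have "\<dots> = (\<Sum>i\<in>A. v i * (\<Sum>j\<in>A. C i j * w j))"
    unfolding sum_distrib_left 
    by (intro sum.cong refl) (simp only: symmetric_onD[OF assms] mult_ac)
  finally show ?thesis .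
qed

text \<open>On the vectors supported on \<open>A\<close>, multiplication by the matrix is an
  injective self-map of a finite set, hence surjective.\<close>

lemma nonsingular_on_solve:
  assumes fin: "finite A" and ns: "nonsingular_on C A"
  obtains v where "\<And>i. i \<notin> A \<Longrightarrow> v i = 0" "\<And>i. i \<in> A \<Longrightarrow> (\<Sum>j\<in>A. C i j * v j) = b i"
proof -
  define V where "V = {v :: 'a \<Rightarrow> bit. \<forall>i. i \<notin> A \<longrightarrow> v i = 0}"
  define T where "T v i = (if i \<in> A then \<Sum>j\<in>A. C i j * v j else 0)" for v i
  have "finite V"
  proof (rule finite_subset)
    show "V \<subseteq> {v. \<forall>x. (x \<in> A \<longrightarrow> v x \<in> UNIV) \<and> (x \<notin> A \<longrightarrow> v x = 0)}"
      by (auto simp: V_def)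
    have "(UNIV :: bit set) = {0, 1}" by auto
    then have "finite (UNIV :: bit set)" by (metis finite.emptyI finite_insert)
    then show "finite {v. \<forall>x. (x \<in> A \<longrightarrow> v x \<in> (UNIV :: bit set)) \<and> (x \<notin> A \<longrightarrow> v x = 0)}"
      by (rule finite_set_of_finite_funs[OF fin])
  qed
  moreover have "inj_on T V"
  proof (rule inj_onI, rule ext)
    fix v w i assume v: "v \<in> V" and w: "w \<in> V" and eq: "T v = T w"
    have "(\<Sum>j\<in>A. C i j * (v j + w j)) = 0" if "i \<in> A" for i
      using that fun_cong[OF eq, of i]
      by (simp add: T_def distrib_left sum.distrib)
    then have "v i + w i = 0" if "i \<in> A" using nonsingular_onD[OF ns, of "\<lambda>j. v j + w j"] that by simp
    then show "v i = w i" using v w by (cases "i \<in> A") (auto simp: V_def bit_add_eq_0_iff)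
  qed
  moreover have "T ` V \<subseteq> V" by (auto simp: T_def V_def)
  ultimately have surj: "T ` V = V" using endo_inj_surj by blast
  have "(\<lambda>i. if i \<in> A then b i else 0) \<in> T ` V" unfolding surj by (simp add: V_def)
  then obtain v where v: "v \<in> V" "T v = (\<lambda>i. if i \<in> A then b i else 0)" by force
  show ?thesis
  proof (rule that)
    show "v i = 0" if "i \<notin> A" for i using v(1) that by (simp add: V_def)
    show "(\<Sum>j\<in>A. C i j * v j) = b i" if "i \<in> A" for i
      using fun_cong[OF v(2), of i] that by (simp add: T_def)
  qed
qed

lemma odd_alternating_kernel:
  assumes "finite A" "odd (card A)" "symmetric_on A C" "\<And>i. i \<in> A \<Longrightarrow> C i i = 0"
  shows "\<exists>w. (\<forall>i\<in>A. (\<Sum>j\<in>A. C i j * w j) = 0) \<and> (\<exists>k\<in>A. w k \<noteq> 0)"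
  using det_on_alternating_odd[OF assms] det_on_nonzero_iff[OF assms(1), of C]
  unfolding nonsingular_on_def by blast

section \<open>The diagonal system and one-element pivots\<close>

text \<open>With d the diagonal of \<open>C\<close> and \<open>v\<close> the solution of C v = d,
  the pairing of d with \<open>v\<close> reads off the parity of |A|. In either parity a singular
  alternating matrix of odd order yields a kernel vector that must agree with
  \<open>v\<close>.\<close>

lemma diagonal_solution_parity:
  fixes C :: "'a \<Rightarrow> 'a \<Rightarrow> bit"
  assumes fin: "finite A" and sym: "symmetric_on A C" and ns: "nonsingular_on C A"
    and v: "\<And>i. i \<in> A \<Longrightarrow> (\<Sum>j\<in>A. C i j * v j) = C i i"
  shows "(\<Sum>i\<in>A. C i i * v i) = of_bool (odd (card A))"
proof -
  \<comment> \<open>Adding the rank-one matrix of the diagonal makes a symmetric matrix over GF(2) alternating.\<close>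
  define K where "K i j = C i j + C i i * C j j" for i j
  have K_sym: "K i j = K j i" if "i \<in> A" "j \<in> A" for i j
    using symmetric_onD[OF sym that] by (simp only: K_def mult_ac)
  have K_diag: "K i i = 0" for i
    by (simp add: K_def bit_mult_self)
  have K_mult: "(\<Sum>j\<in>A. K i j * w j) = (\<Sum>j\<in>A. C i j * w j) + C i i * (\<Sum>j\<in>A. C j j * w j)" for i w
    by (simp only: K_def distrib_right sum.distrib sum_distrib_left mult.assoc)
  have unique: "w i = v i"
    if "\<And>i. i \<in> A \<Longrightarrow> (\<Sum>j\<in>A. C i j * w j) = C i i" "i \<in> A" for w i
  proof -
    have "(\<Sum>j\<in>A. C i j * (w j + v j)) = 0" if "i \<in> A" for i
      using \<open>\<And>i. i \<in> A \<Longrightarrow> (\<Sum>j\<in>A. C i j * w j) = C i i\<close>[OF that] v[OF that]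
      by (simp add: distrib_left sum.distrib)
    from nonsingular_onD[OF ns this \<open>i \<in> A\<close>] show ?thesis by (simp add: bit_add_eq_0_iff)
  qed
  show ?thesis
  proof (cases "odd (card A)")
    case True
    have "symmetric_on A K" unfolding symmetric_on_def using K_sym by blast
    then obtain w k where w: "\<And>i. i \<in> A \<Longrightarrow> (\<Sum>j\<in>A. K i j * w j) = 0" "k \<in> A" "w k \<noteq> 0"
      using odd_alternating_kernel[of A K, OF fin True _ K_diag] by blast
    \<comment> \<open>Since K = C + d d^T, a kernel vector \<open>w\<close> of \<open>K\<close>
      satisfies C w = c d; non-singularity of \<open>C\<close> forces c = 1, so \<open>w\<close> is
      the solution \<open>v\<close>.\<close>
    define c where "c = (\<Sum>j\<in>A. C j j * w j)"
    have Cw: "(\<Sum>j\<in>A. C i j * w j) = C i i * c" if "i \<in> A" for i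
      using w(1)[OF that] by (simp add: K_mult c_def bit_add_eq_0_iff)
    have "c \<noteq> 0"
    proof
      assume "c = 0"
      then have "(\<Sum>j\<in>A. C i j * w j) = 0" if "i \<in> A" for i using Cw[OF that] by simp
      from nonsingular_onD[OF ns this w(2)] have "w k = 0" .
      then show False using w(3) by simp
    qed
    then have c: "c = 1" by simp
    have wv: "w i = v i" if "i \<in> A" for i
      by (rule unique[OF _ that]) (simp add: Cw c)
    have "(\<Sum>i\<in>A. C i i * v i) = (\<Sum>i\<in>A. C i i * w i)"
      by (rule sum.cong[OF refl]) (simp only: wv)
    also have "\<dots> = 1" using c by (simp only: c_def)
    finally show ?thesis using True by simp
  next
    case False
    \<comment> \<open>For even |A|, bordering \<open>K\<close> by the diagonal with corner 0 gives
      an alternating matrix of odd order. Its row \<open>None\<close> makes d orthogonal to the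
      kernel vector, so the rank-one part of \<open>K\<close> drops out of the other rows.\<close>
    define N where "N x y = (case (x, y) of (Some i, Some j) \<Rightarrow> K i j
      | (Some i, None) \<Rightarrow> C i i | (None, Some j) \<Rightarrow> C j j | (None, None) \<Rightarrow> 0)" for x y
    let ?B = "insert None (Some ` A)"
    have sum_B: "(\<Sum>y\<in>?B. g y) = g None + (\<Sum>j\<in>A. g (Some j))" for g :: "'a option \<Rightarrow> bit"
      using fin by (simp add: sum.reindex)
    have B: "finite ?B" "odd (card ?B)"
      using fin False by (simp_all add: card_image)
    have N_sym: "symmetric_on ?B N"
      unfolding symmetric_on_def N_def by (auto intro: K_sym)
    have N_diag: "N x x = 0" for x
      by (cases x) (simp_all add: N_def K_diag)
    obtain w k
      where w: "\<And>i. i \<in> ?B \<Longrightarrow> (\<Sum>j\<in>?B. N i j * w j) = 0" "k \<in> ?B" "w k \<noteq> 0"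
      using odd_alternating_kernel[of ?B N, OF B N_sym N_diag] by blast
    define u where "u j = w (Some j)" for j
    have c: "(\<Sum>j\<in>A. C j j * u j) = 0"
      using w(1)[of None] unfolding sum_B by (simp add: N_def u_def)
    have Cu: "(\<Sum>j\<in>A. C i j * u j) = C i i * w None" if "i \<in> A" for i
    proof -
      have "C i i * w None + (\<Sum>j\<in>A. K i j * u j) = 0"
        using w(1)[of "Some i"] that unfolding sum_B by (simp add: N_def u_def)
      then show ?thesis by (simp add: K_mult c bit_add_eq_0_iff)
    qed
    have "w None \<noteq> 0"
    proof
      assume 0: "w None = 0"
      then have "(\<Sum>j\<in>A. C i j * u j) = 0" if "i \<in> A" for i using Cu[OF that] by simp
      from nonsingular_onD[OF ns this] have "\<forall>i\<in>A. u i = 0" by blast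
      then show False using w(2,3) 0 by (auto simp: u_def)
    qed
    then have a: "w None = 1" by simp
    have uv: "u i = v i" if "i \<in> A" for i
      by (rule unique[OF _ that]) (simp add: Cu a)
    have "(\<Sum>i\<in>A. C i i * v i) = (\<Sum>j\<in>A. C j j * u j)"
      by (rule sum.cong[OF refl]) (simp only: uv)
    then show ?thesis using c False by simp
  qed
qed

text \<open>Over GF(2) the solution \<open>v\<close> of the diagonal system is the diagonal of the
  inverse matrix, and a nonzero diagonal entry of the inverse means that the complementary principal
  minor is nonzero.\<close>

lemma nonsingular_on_remove:
  fixes C :: "'a \<Rightarrow> 'a \<Rightarrow> bit"
  assumes fin: "finite A" and sym: "symmetric_on A C" and ns: "nonsingular_on C A"
    and v: "\<And>i. i \<in> A \<Longrightarrow> (\<Sum>j\<in>A. C i j * v j) = C i i"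
    and e: "e \<in> A" "v e \<noteq> 0"
  shows "nonsingular_on C (A - {e})"
  unfolding nonsingular_on_def
proof (intro allI impI ballI)
  fix w i
  assume w: "\<forall>i\<in>A - {e}. (\<Sum>j\<in>A - {e}. C i j * w j) = 0" and i: "i \<in> A - {e}"
  \<comment> \<open>A kernel vector of the smaller matrix, extended by 0 at \<open>e\<close>, is
    mapped by \<open>C\<close> to a vector concentrated at \<open>e\<close>.\<close>
  define u where "u = w(e := 0)"
  define Cu where "Cu i = (\<Sum>j\<in>A. C i j * u j)" for i
  have Cu0: "Cu i = 0" if "i \<in> A - {e}" for i
  proof -
    have "Cu i = C i e * u e + (\<Sum>j\<in>A - {e}. C i j * u j)"
      unfolding Cu_def by (rule sum.remove[OF fin e(1)])
    also have "\<dots> = (\<Sum>j\<in>A - {e}. C i j * w j)" by (simp add: u_def)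
    finally show ?thesis using w that by simp
  qed
  have concentrated: "(\<Sum>i\<in>A. x i * Cu i) = x e * Cu e" for x
    by (subst sum.remove[OF fin e(1)]) (simp add: Cu0)
  \<comment> \<open>The remaining entry is the pairing of \<open>v\<close> with C u, hence of d with
    \<open>u\<close>, hence the quadratic form at \<open>u\<close>; that is 0 because
    \<open>u\<close> vanishes at \<open>e\<close>.\<close>
  have "Cu e = v e * Cu e" using e(2) by simp
  also have "\<dots> = (\<Sum>i\<in>A. u i * (\<Sum>j\<in>A. C i j * v j))"
    using concentrated[of v] bilinear_form_commute[OF sym, of v u] by (simp add: Cu_def)
  also have "\<dots> = (\<Sum>i\<in>A. C i i * u i)"
    by (rule sum.cong[OF refl]) (subst v, assumption, rule mult.commute)
  also have "\<dots> = (\<Sum>i\<in>A. u i * Cu i)"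
    unfolding Cu_def by (rule quadratic_form_eq_diagonal[OF fin sym, symmetric])
  also have "\<dots> = 0" using concentrated[of u] by (simp add: u_def)
  finally have "Cu i = 0" if "i \<in> A" for i
    using Cu0[of i] that by (cases "i = e") auto
  then have "u i = 0" using nonsingular_onD[OF ns, of u i] i by (simp add: Cu_def)
  then show "w i = 0" using i by (simp add: u_def)
qed

text \<open>Over GF(2) the Schur complement of \<open>A\<close> at \<open>e\<close> is
  \<open>C e e\<close> plus the sum of \<open>C e j * v j\<close>; the last assumption says that it
  is nonzero.\<close>

lemma nonsingular_on_insert:
  fixes C :: "'a \<Rightarrow> 'a \<Rightarrow> bit"
  assumes fin: "finite A" and e: "e \<notin> A" and sym: "symmetric_on (insert e A) C"
    and ns: "nonsingular_on C A"
    and v: "\<And>i. i \<in> A \<Longrightarrow> (\<Sum>j\<in>A. C i j * v j) = C i i"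
    and ve: "(\<Sum>j\<in>A. C e j * v j) \<noteq> C e e"
  shows "nonsingular_on C (insert e A)"
  unfolding nonsingular_on_def
proof (intro allI impI ballI)
  fix w i
  assume w: "\<forall>i\<in>insert e A. (\<Sum>j\<in>insert e A. C i j * w j) = 0" and i: "i \<in> insert e A"
  define u where "u = v(e := 0)"
  have Cu: "(\<Sum>j\<in>insert e A. C i j * u j) = (\<Sum>j\<in>A. C i j * v j)" for i
  proof -
    have "(\<Sum>j\<in>A. C i j * u j) = (\<Sum>j\<in>A. C i j * v j)"
      by (rule sum.cong[OF refl]) (use e in \<open>auto simp: u_def\<close>)
    then show ?thesis using fin e by (simp add: u_def)
  qed
  have ve': "(\<Sum>j\<in>A. C e j * v j) = C e e + 1"
    using ve by (cases "C e e") auto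
  \<comment> \<open>For a kernel vector \<open>w\<close>, both its pairing with C u and its
    quadratic form are 0. The two expand to expressions differing by exactly \<open>w e\<close>, so
    \<open>w e\<close> is 0 and \<open>w\<close> restricts to a kernel vector on
    \<open>A\<close>.\<close>
  have "0 = (\<Sum>i\<in>insert e A. u i * (\<Sum>j\<in>insert e A. C i j * w j))"
    using w by (metis (no_types, lifting) mult_zero_right sum.neutral)
  also have "\<dots> = (\<Sum>i\<in>insert e A. w i * (\<Sum>j\<in>A. C i j * v j))"
    by (simp only: bilinear_form_commute[OF sym, of u w] Cu)
  also have "\<dots> = w e * (C e e + 1) + (\<Sum>i\<in>A. w i * (\<Sum>j\<in>A. C i j * v j))"
    by (simp only: sum.insert[OF fin e] ve')
  also have "(\<Sum>i\<in>A. w i * (\<Sum>j\<in>A. C i j * v j)) = (\<Sum>i\<in>A. C i i * w i)"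
    by (rule sum.cong[OF refl]) (subst v, assumption, rule mult.commute)
  also have "w e * (C e e + 1) + (\<Sum>i\<in>A. C i i * w i) = w e + (\<Sum>i\<in>insert e A. C i i * w i)"
    using fin e by (simp add: distrib_left ac_simps)
  also have "(\<Sum>i\<in>insert e A. C i i * w i) = 0"
    using quadratic_form_eq_diagonal[OF _ sym, of w] fin w
    by (metis (no_types, lifting) finite_insert mult_zero_right sum.neutral)
  finally have we: "w e = 0" by simp
  then have "(\<Sum>j\<in>A. C i j * w j) = 0" if "i \<in> A" for i
    using w that fin e by simp
  then show "w i = 0" using nonsingular_onD[OF ns, of w i] i we by auto
qed

section \<open>Symmetric differences and the exchange property of binary delta-matroids\<close>

lemma symdiff_iff: "x \<in> X \<triangle> Y \<longleftrightarrow> (x \<in> X) \<noteq> (x \<in> Y)"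
  by (auto simp: symdiff_def)

lemma finite_symdiff [simp]: "finite X \<Longrightarrow> finite Y \<Longrightarrow> finite (X \<triangle> Y)"
  by (simp add: symdiff_def)

lemma odd_card_symdiff:
  assumes "finite X" "finite Y"
  shows "odd (card (X \<triangle> Y)) \<longleftrightarrow> odd (card X) \<noteq> odd (card Y)"
proof -
  have "card (X \<triangle> Y) = card (X - Y) + card (Y - X)"
    unfolding symdiff_def using assms by (intro card_Un_disjoint) auto
  moreover have "card X = card (X - Y) + card (X \<inter> Y)" "card Y = card (Y - X) + card (X \<inter> Y)"
    using card_Int_Diff[of X Y] card_Int_Diff[of Y X] assms by (simp_all add: Int_commute)
  ultimately show ?thesis by auto
qed

text \<open>The exchange axiom with v = u, for a suitable u, when the two feasible sets differ in
  parity. This is the consequence of binary representability on which the distance arguments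
  rest.\<close>

definition odd_exchange :: "'a set set \<Rightarrow> bool" where
  "odd_exchange F \<longleftrightarrow>
     (\<forall>X\<in>F. \<forall>Y\<in>F. odd (card (X \<triangle> Y)) \<longrightarrow> (\<exists>e\<in>X \<triangle> Y. X \<triangle> {e} \<in> F))"

text \<open>The diagonal solution \<open>v\<close> on \<open>X\<close> detects one-element moves: a
  nonzero coordinate in X - Y allows a deletion, and a violated diagonal equation in Y - X allows an
  insertion.\<close>

lemma odd_exchange_DC:
  assumes fin: "finite E" and sym: "symmetric_on E C"
  shows "odd_exchange (DC E C)"
  unfolding odd_exchange_def
proof (intro ballI impI)
  fix X Y assume X: "X \<in> DC E C" and Y: "Y \<in> DC E C" and odd: "odd (card (X \<triangle> Y))"
  have DC_iff: "Z \<in> DC E C \<longleftrightarrow> Z \<subseteq> E \<and> nonsingular_on C Z" for Z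
    using det_on_nonzero_iff[of Z C] finite_subset[OF _ fin] by (auto simp: DC_def)
  have XE: "X \<subseteq> E" and YE: "Y \<subseteq> E" and nsX: "nonsingular_on C X" and nsY: "nonsingular_on C Y"
    using X Y by (simp_all add: DC_iff)
  have finX: "finite X" and finY: "finite Y" using XE YE fin finite_subset by auto
  note sub = symmetric_on_subset[OF sym]
  obtain v where v0: "\<And>i. i \<notin> X \<Longrightarrow> v i = 0" and v: "\<And>i. i \<in> X \<Longrightarrow> (\<Sum>j\<in>X. C i j * v j) = C i i"
    using nonsingular_on_solve[OF finX nsX, of "\<lambda>i. C i i"] by blast
  show "\<exists>e\<in>X \<triangle> Y. X \<triangle> {e} \<in> DC E C"
  proof (rule ccontr)
    assume none: "\<not> ?thesis"
    \<comment> \<open>Then \<open>v\<close> also solves the diagonal system on \<open>Y\<close>, so \<open>X\<close> and \<open>Y\<close> have the same parity.\<close>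
    have vX: "v e = 0" if "e \<in> X - Y" for e
    proof (rule ccontr)
      assume "v e \<noteq> 0"
      then have "X - {e} \<in> DC E C"
        using nonsingular_on_remove[OF finX sub[OF XE] nsX v] that XE by (auto simp: DC_iff)
      moreover have "X \<triangle> {e} = X - {e}" "e \<in> X \<triangle> Y" using that by (auto simp: symdiff_def)
      ultimately show False using none by metis
    qed
    have vY: "(\<Sum>j\<in>X. C e j * v j) = C e e" if "e \<in> Y - X" for e
    proof (rule ccontr)
      assume "(\<Sum>j\<in>X. C e j * v j) \<noteq> C e e"
      then have "nonsingular_on C (insert e X)"
        using that XE YE by (intro nonsingular_on_insert[OF finX _ sub nsX v]) auto
      then have "insert e X \<in> DC E C" using that XE YE by (auto simp: DC_iff)
      moreover have "X \<triangle> {e} = insert e X" "e \<in> X \<triangle> Y" using that by (auto simp: symdiff_def)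
      ultimately show False using none by metis
    qed
    \<comment> \<open>As \<open>v\<close> vanishes off \<open>X\<close> and on X - Y, sums over
      \<open>X\<close> and over \<open>Y\<close> both reduce to the intersection.\<close>
    have supp: "(\<Sum>j\<in>Y. g j * v j) = (\<Sum>j\<in>X. g j * v j)" for g
    proof -
      have "(\<Sum>j\<in>X \<inter> Y. g j * v j) = (\<Sum>j\<in>X. g j * v j)"
        by (rule sum.mono_neutral_left[OF finX]) (use vX in auto)
      moreover have "(\<Sum>j\<in>X \<inter> Y. g j * v j) = (\<Sum>j\<in>Y. g j * v j)"
        by (rule sum.mono_neutral_left[OF finY]) (use v0 in auto)
      ultimately show ?thesis by simp
    qed
    have "(\<Sum>j\<in>Y. C i j * v j) = C i i" if "i \<in> Y" for i
      unfolding supp using v[of i] vY[of i] that by blast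
    then have "(of_bool (odd (card Y)) :: bit) = of_bool (odd (card X))"
      using diagonal_solution_parity[OF finY sub[OF YE] nsY]
        diagonal_solution_parity[OF finX sub[OF XE] nsX v] supp by metis
    then show False using odd odd_card_symdiff[OF finX finY] by (auto split: if_splits)
  qed
qed

text \<open>Twisting leaves the symmetric difference of two feasible sets unchanged.\<close>

lemma odd_exchange_untwist:
  assumes "odd_exchange (twist F A)"
  shows "odd_exchange F"
  unfolding odd_exchange_def
proof (intro ballI impI)
  fix X Y assume X: "X \<in> F" and Y: "Y \<in> F" and odd: "odd (card (X \<triangle> Y))"
  have eq: "(A \<triangle> X) \<triangle> (A \<triangle> Y) = X \<triangle> Y" by (auto simp: symdiff_def)
  have "A \<triangle> X \<in> twist F A" "A \<triangle> Y \<in> twist F A" using X Y by (auto simp: twist_def)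
  then obtain e where e: "e \<in> X \<triangle> Y" "(A \<triangle> X) \<triangle> {e} \<in> twist F A"
    using assms odd eq unfolding odd_exchange_def by metis
  then obtain Z where Z: "Z \<in> F" "(A \<triangle> X) \<triangle> {e} = A \<triangle> Z" by (auto simp: twist_def)
  have "X \<triangle> {e} = A \<triangle> ((A \<triangle> X) \<triangle> {e})" by (auto simp: symdiff_iff)
  also have "\<dots> = Z" unfolding Z(2) by (auto simp: symdiff_iff)
  finally have "X \<triangle> {e} = Z" .
  with Z e show "\<exists>e\<in>X \<triangle> Y. X \<triangle> {e} \<in> F" by auto
qed

lemma odd_exchange_binary:
  assumes ss: "set_system E F" and bin: "binary_dm E F"
  shows "odd_exchange F"
proof -
  obtain A where A: "A \<subseteq> E"
    and "\<exists>(E'::'a set) C. symmetric_on E' C \<and> iso_set_system E (twist F A) E' (DC E' C)"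
    using bin unfolding binary_dm_def by blast
  then obtain E' :: "'a set" and C where sym: "symmetric_on E' C"
    and iso: "iso_set_system E (twist F A) E' (DC E' C)"
    by blast
  obtain f where f: "bij_betw f E E'" and img: "(\<lambda>X. f ` X) ` twist F A = DC E' C"
    using iso unfolding iso_set_system_def by blast
  \<comment> \<open>Pulling the matrix back along the isomorphism represents the twist on
    \<open>E\<close> itself.\<close>
  define C' where "C' i j = C (f i) (f j)" for i j
  have fin: "finite E" using ss by (simp add: set_system_def)
  have inj: "inj_on f E" and E': "E' = f ` E" using f unfolding bij_betw_def by blast+
  have sym': "symmetric_on E C'"
    unfolding symmetric_on_def C'_def by (intro ballI symmetric_onD[OF sym]) (simp_all add: E')
  have sub: "X \<subseteq> E" if "X \<in> twist F A" for X
  proof -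
    obtain Y where "Y \<in> F" "X = A \<triangle> Y" using \<open>X \<in> twist F A\<close> by (auto simp: twist_def)
    then show ?thesis using ss A by (auto simp: set_system_def symdiff_def)
  qed
  have "X \<in> twist F A \<longleftrightarrow> X \<in> DC E C'" for X
  proof (cases "X \<subseteq> E")
    case X: True
    have "X \<in> twist F A \<longleftrightarrow> f ` X \<in> DC E' C"
    proof
      assume "f ` X \<in> DC E' C"
      then obtain Y where Y: "Y \<in> twist F A" "f ` X = f ` Y" unfolding img[symmetric] by blast
      then have "X = Y" using inj_on_image_eq_iff[OF inj X sub[OF Y(1)]] by blast
      then show "X \<in> twist F A" using Y(1) by blast
    qed (unfold img[symmetric], rule imageI)
    also have "\<dots> \<longleftrightarrow> det_on C (f ` X) \<noteq> 0"
      unfolding DC_def E' using image_mono[OF X, of f] by blast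
    also have "\<dots> \<longleftrightarrow> X \<in> DC E C'"
      unfolding det_on_image[OF inj_on_subset[OF inj X] finite_subset[OF X fin]] DC_def C'_def
      using X by blast
    finally show ?thesis .
  next
    case False
    then show ?thesis using sub by (auto simp: DC_def)
  qed
  then have "twist F A = DC E C'" by blast
  then have "odd_exchange (twist F A)" using odd_exchange_DC[OF fin sym'] by simp
  then show ?thesis by (rule odd_exchange_untwist)
qed

section \<open>Distance to a delta-matroid\<close>

definition distance :: "'a set set \<Rightarrow> 'a set \<Rightarrow> nat" where
  "distance F X = Min ((\<lambda>Y. card (X \<triangle> Y)) ` F)"

context
  fixes E :: "'a set" and F :: "'a set set"
  assumes dm: "delta_matroid E F"
begin

lemma finite_ground: "finite E" and nonempty: "F \<noteq> {}"
  and feasible_subset: "X \<in> F \<Longrightarrow> X \<subseteq> E"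
  and exchange: "X \<in> F \<Longrightarrow> Y \<in> F \<Longrightarrow> u \<in> X \<triangle> Y \<Longrightarrow> \<exists>v\<in>X \<triangle> Y. X \<triangle> {u, v} \<in> F"
  using dm unfolding delta_matroid_def set_system_def by blast+

lemma finite_feasible: "finite F"
  using feasible_subset finite_ground by (meson Pow_iff finite_Pow_iff finite_subset subsetI)

lemma finite_subset_ground: "X \<subseteq> E \<Longrightarrow> finite X"
  using finite_ground finite_subset by blast

lemma distance_le: "Y \<in> F \<Longrightarrow> distance F X \<le> card (X \<triangle> Y)"
  unfolding distance_def using finite_feasible by (intro Min_le) auto

lemma distance_attained:
  obtains Y where "Y \<in> F" "card (X \<triangle> Y) = distance F X"
proof -
  have "distance F X \<in> (\<lambda>Y. card (X \<triangle> Y)) ` F"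
    unfolding distance_def using finite_feasible nonempty by (intro Min_in) auto
  then show thesis using that by auto
qed

lemma distance_step:
  assumes "B \<subseteq> E"
  shows "distance F (B \<triangle> {e}) \<le> distance F B + 1"
proof -
  obtain Y where Y: "Y \<in> F" "card (B \<triangle> Y) = distance F B" by (rule distance_attained)
  have fin: "finite (B \<triangle> Y)"
    using finite_subset_ground assms feasible_subset[OF Y(1)] by simp
  have "card ((B \<triangle> {e}) \<triangle> Y) \<le> card (insert e (B \<triangle> Y))"
    using fin by (intro card_mono) (auto simp: symdiff_def)
  also have "\<dots> \<le> card (B \<triangle> Y) + 1" using fin by (simp add: card_insert_if)
  finally show ?thesis using distance_le[OF Y(1), of "B \<triangle> {e}"] Y(2) by simp
qed

text \<open>Within \<open>E\<close>, the sets A \<triangle> Y and (E - A) \<triangle> Y are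
  complementary, so the largest size in the twist by \<open>A\<close> is |E| minus the distance of E
  - A.\<close>

lemma width_plus_distances:
  assumes A: "A \<subseteq> E"
  shows "width (twist F A) + distance F A + distance F (E - A) = card E"
proof -
  have card_sum: "card (A \<triangle> Y) + card ((E - A) \<triangle> Y) = card E" if "Y \<in> F" for Y
  proof -
    have "(E - A) \<triangle> Y = E - A \<triangle> Y" "A \<triangle> Y \<subseteq> E"
      using A feasible_subset[OF that] by (auto simp: symdiff_def)
    then show ?thesis
      using card_Diff_subset[of "A \<triangle> Y" E] card_mono[of E "A \<triangle> Y"] finite_subset_ground finite_ground
      by simp
  qed
  have cards: "card ` twist F A = (\<lambda>Y. card (A \<triangle> Y)) ` F"
    by (auto simp: twist_def image_image)
  obtain Z where Z: "Z \<in> F" "card ((E - A) \<triangle> Z) = distance F (E - A)" by (rule distance_attained)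
  have "Max (card ` twist F A) = card (A \<triangle> Z)"
    unfolding cards
  proof (rule Max_eqI)
    show "y \<le> card (A \<triangle> Z)" if "y \<in> (\<lambda>Y. card (A \<triangle> Y)) ` F" for y
      using that card_sum[OF Z(1)] card_sum distance_le[of _ "E - A"] Z(2) by fastforce
  qed (use Z finite_feasible in auto)
  moreover have "Min (card ` twist F A) = distance F A"
    by (simp add: cards distance_def)
  moreover have "distance F A \<le> card (A \<triangle> Z)" using Z(1) by (rule distance_le)
  ultimately show ?thesis using card_sum[OF Z(1)] Z(2) by (simp add: width_def)
qed

text \<open>Among the feasible sets nearest to \<open>Z\<close>, take one nearest to
  \<open>X\<close>. If it differed from \<open>X\<close> at some u where \<open>X\<close> and
  \<open>Z\<close> agree, an exchange at u towards \<open>X\<close> would bring it closer to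
  \<open>X\<close> without moving it away from \<open>Z\<close>.\<close>

lemma closest_feasible_between:
  assumes X: "X \<in> F" and Z: "Z \<subseteq> E"
  obtains G where "G \<in> F" "card (Z \<triangle> G) = distance F Z" "X \<triangle> G \<subseteq> X \<triangle> Z"
proof -
  let ?P = "\<lambda>G. G \<in> F \<and> card (Z \<triangle> G) = distance F Z"
  obtain G where G: "?P G" and min: "\<And>H. ?P H \<Longrightarrow> card (X \<triangle> G) \<le> card (X \<triangle> H)"
    using ex_has_least_nat[of ?P _ "\<lambda>G. card (X \<triangle> G)"] distance_attained[of Z] by metis
  have fin: "finite X" "finite Z" "finite G"
    using X Z G feasible_subset finite_subset_ground by auto
  have "X \<triangle> G \<subseteq> X \<triangle> Z"
  proof
    fix u assume u: "u \<in> X \<triangle> G"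
    show "u \<in> X \<triangle> Z"
    proof (rule ccontr)
      assume "u \<notin> X \<triangle> Z"
      then have uZ: "u \<in> Z \<triangle> G" using u by (auto simp: symdiff_iff)
      have "u \<in> G \<triangle> X" using u by (auto simp: symdiff_iff)
      then obtain v where v: "v \<in> G \<triangle> X" "G \<triangle> {u, v} \<in> F"
        using exchange[of G X u] G X by blast
      \<comment> \<open>The element \<open>u\<close> leaves the difference with \<open>Z\<close>,
        which pays for the possible entry of \<open>v\<close>.\<close>
      have "card (Z \<triangle> (G \<triangle> {u, v})) \<le> card (insert v (Z \<triangle> G - {u}))"
        using fin uZ by (intro card_mono) (auto simp: symdiff_iff)
      also have "\<dots> \<le> Suc (card (Z \<triangle> G - {u}))"
        using fin by (simp add: card_insert_if)
      also have "\<dots> = card (Z \<triangle> G)"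
        using fin by (intro card_Suc_Diff1[OF _ uZ]) simp
      finally have "?P (G \<triangle> {u, v})" using v(2) G distance_le[OF v(2), of Z] by simp
      moreover have "card (X \<triangle> (G \<triangle> {u, v})) < card (X \<triangle> G)"
        using fin u v(1) by (intro psubset_card_mono) (auto simp: symdiff_iff)
      ultimately show False using min by fastforce
    qed
  qed
  with G that show thesis by blast
qed

text \<open>For \<open>Y\<close> nearest to \<open>B\<close> and a suitable \<open>G\<close> nearest
  to B \<triangle> S, the claim reduces to |Y \<triangle> G| being even. Otherwise odd exchange
  moves \<open>Y\<close> by one element \<open>e\<close>, which contradicts \<open>far\<close> if
  \<open>e\<close> is in \<open>S\<close> and the minimality of \<open>Y\<close> if not.\<close>

lemma distance_parity:
  assumes odd_ex: "odd_exchange F" and B: "B \<subseteq> E" and S: "S \<subseteq> E"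
    and far: "\<And>e. e \<in> S \<Longrightarrow> distance F (B \<triangle> {e}) = distance F B + 1"
  shows "odd (distance F (B \<triangle> S)) \<longleftrightarrow> odd (distance F B + card S)"
proof -
  obtain Y where Y: "Y \<in> F" "card (B \<triangle> Y) = distance F B" by (rule distance_attained)
  have BS: "B \<triangle> S \<subseteq> E" using B S by (auto simp: symdiff_def)
  obtain G where G: "G \<in> F" "card ((B \<triangle> S) \<triangle> G) = distance F (B \<triangle> S)"
      "Y \<triangle> G \<subseteq> Y \<triangle> (B \<triangle> S)"
    by (rule closest_feasible_between[OF Y(1) BS])
  have fin: "finite B" "finite S" "finite Y" "finite G"
    using B S Y G feasible_subset finite_subset_ground by auto
  have "even (card (Y \<triangle> G))"
  proof (rule ccontr)
    assume "odd (card (Y \<triangle> G))"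
    then obtain e where e: "e \<in> Y \<triangle> G" "Y \<triangle> {e} \<in> F"
      using odd_ex Y(1) G(1) unfolding odd_exchange_def by blast
    show False
    proof (cases "e \<in> S")
      case True
      have "(B \<triangle> {e}) \<triangle> (Y \<triangle> {e}) = B \<triangle> Y" by (auto simp: symdiff_iff)
      then show False using distance_le[OF e(2), of "B \<triangle> {e}"] far[OF True] Y(2) by simp
    next
      case False
      \<comment> \<open>The choice of \<open>G\<close> confines Y \<triangle> G to the symmetric
        difference of B \<triangle> Y and \<open>S\<close>.\<close>
      then have "e \<in> B \<triangle> Y" using e(1) G(3) by (auto simp: symdiff_iff)
      then have "card (B \<triangle> (Y \<triangle> {e})) < card (B \<triangle> Y)"
        using fin by (intro psubset_card_mono) (auto simp: symdiff_iff)
      then show False using distance_le[OF e(2), of B] Y(2) by simp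
    qed
  qed
  moreover have "(B \<triangle> S) \<triangle> G = (B \<triangle> Y) \<triangle> (S \<triangle> (Y \<triangle> G))"
    by (auto simp: symdiff_iff)
  ultimately show ?thesis
    using fin Y(2) G(2) odd_card_symdiff[of "B \<triangle> Y" "S \<triangle> (Y \<triangle> G)"] odd_card_symdiff[of S "Y \<triangle> G"]
    by auto
qed

section \<open>Parity and interpolation of twist widths\<close>

text \<open>Each of the two distances grows by at most 1 in a step, so a drop of 2 in the width
  makes both grow by exactly 1. The parity statement then applies to \<open>B\<close> and to its
  complement, and the two contributions of |S| cancel.\<close>

lemma width_parity:
  assumes odd_ex: "odd_exchange F" and B: "B \<subseteq> E" and S: "S \<subseteq> E"
    and drop: "\<And>e. e \<in> S \<Longrightarrow> width (twist F (B \<triangle> {e})) + 2 \<le> width (twist F B)"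
  shows "even (width (twist F (B \<triangle> S))) \<longleftrightarrow> even (width (twist F B))"
proof -
  have compl: "E - B \<triangle> X = (E - B) \<triangle> X" "B \<triangle> X \<subseteq> E" if "X \<subseteq> E" for X
    using that B by (auto simp: symdiff_def)
  have up: "distance F (B \<triangle> {e}) = distance F B + 1 \<and>
      distance F ((E - B) \<triangle> {e}) = distance F (E - B) + 1" if e: "e \<in> S" for e
  proof -
    have "{e} \<subseteq> E" using e S by blast
    note c = compl[OF this]
    show ?thesis
      using drop[OF e] width_plus_distances[OF B] width_plus_distances[OF c(2)]
        distance_step[OF B, of e] distance_step[of "E - B" e] unfolding c(1) by auto
  qed
  have "odd (distance F (B \<triangle> S)) \<longleftrightarrow> odd (distance F B + card S)"
    using up by (intro distance_parity[OF odd_ex B S]) auto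
  moreover have "odd (distance F ((E - B) \<triangle> S)) \<longleftrightarrow> odd (distance F (E - B) + card S)"
    using up by (intro distance_parity[OF odd_ex _ S]) auto
  moreover have "even (width (twist F (B \<triangle> S)) + distance F (B \<triangle> S) + distance F ((E - B) \<triangle> S))
      \<longleftrightarrow> even (width (twist F B) + distance F B + distance F (E - B))"
    using width_plus_distances[OF B] width_plus_distances[OF compl(2)[OF S]] compl(1)[OF S] by simp
  ultimately show ?thesis by auto
qed

lemma width_step:
  assumes B: "B \<subseteq> E" and e: "e \<in> E"
  shows "width (twist F B) \<le> width (twist F (B \<triangle> {e})) + 2"
proof -
  have c: "E - B \<triangle> {e} = (E - B) \<triangle> {e}" "B \<triangle> {e} \<subseteq> E" using B e by (auto simp: symdiff_def)
  show ?thesis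
    using width_plus_distances[OF B] width_plus_distances[OF c(2)]
      distance_step[OF B, of e] distance_step[of "E - B" e] unfolding c(1) by auto
qed

lemma width_interpolation:
  assumes odd_ex: "odd_exchange F"
    and A: "A \<subseteq> E" "width (twist F A) < m" "even (width (twist F A)) \<longleftrightarrow> even m"
    and B: "B \<subseteq> E" "m \<le> width (twist F B)"
  shows "\<exists>X\<subseteq>E. width (twist F X) = m"
proof (rule ccontr)
  assume gap: "\<not> ?thesis"
  \<comment> \<open>With a non-strict bound, minimality puts every next set towards \<open>A\<close>
    strictly below \<open>m\<close>; the assumed gap makes the bound strict for the chosen set
    itself.\<close>
  let ?P = "\<lambda>X. X \<subseteq> E \<and> m \<le> width (twist F X)"
  obtain X where X: "?P X" and min: "\<And>Y. ?P Y \<Longrightarrow> card (X \<triangle> A) \<le> card (Y \<triangle> A)"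
    using ex_has_least_nat[of ?P B "\<lambda>X. card (X \<triangle> A)"] B by blast
  have fin: "finite X" "finite A" using X A finite_subset_ground by auto
  have XA: "X \<triangle> A \<subseteq> E" using X A by (auto simp: symdiff_def)
  have below: "width (twist F (X \<triangle> {e})) < m" if e: "e \<in> X \<triangle> A" for e
  proof (rule ccontr)
    assume "\<not> ?thesis"
    moreover have "X \<triangle> {e} \<subseteq> E" using X XA e by (auto simp: symdiff_def)
    ultimately have "card (X \<triangle> A) \<le> card ((X \<triangle> {e}) \<triangle> A)" by (intro min) simp
    moreover have "card ((X \<triangle> {e}) \<triangle> A) < card (X \<triangle> A)"
      using fin e by (intro psubset_card_mono) (auto simp: symdiff_iff)
    ultimately show False by simp
  qed
  have "width (twist F X) \<noteq> m" using X gap by blast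
  then have above: "m < width (twist F X)" using X by simp
  have "X \<triangle> (X \<triangle> A) = A" by (auto simp: symdiff_iff)
  moreover have "width (twist F (X \<triangle> {e})) + 2 \<le> width (twist F X)" if "e \<in> X \<triangle> A" for e
    using below[OF that] above by simp
  ultimately have parity: "even (width (twist F A)) \<longleftrightarrow> even (width (twist F X))"
    using width_parity[OF odd_ex conjunct1[OF X] XA] by simp
  have "X \<noteq> A" using A(2) above by auto
  then obtain e where e: "e \<in> X \<triangle> A" by (auto simp: symdiff_def)
  have "width (twist F X) = m + 1"
    using above below[OF e] width_step[OF conjunct1[OF X] subsetD[OF XA e]] by simp
  then show False using A(3) parity by simp
qed

end

theorem theorem3:
  fixes E :: "'a set" and F :: "'a set set" and k m :: nat
  assumes "delta_matroid E F"
    and "binary_dm E F"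
    and "k \<in> twist_widths E F"
    and "k + 1 \<in> twist_widths E F"
    and "k + 2 \<le> m"
    and "m \<le> max_twist_width E F"
  shows "m \<in> twist_widths E F"
proof -
  have widths: "twist_widths E F = (\<lambda>A. width (twist F A)) ` Pow E"
    by (auto simp: twist_widths_def)
  have "finite (twist_widths E F)"
    using finite_ground[OF assms(1)] by (simp add: widths)
  then have "max_twist_width E F \<in> twist_widths E F"
    unfolding max_twist_width_def using assms(3) by (intro Max_in) auto
  then obtain B where B: "B \<subseteq> E" "m \<le> width (twist F B)"
    using assms(6) by (auto simp: widths)
  \<comment> \<open>One of \<open>k\<close> and \<open>k + 1\<close> has the parity of
    \<open>m\<close>, and both lie below \<open>m\<close> because k + 2 <= m.\<close>
  have "\<exists>i\<in>twist_widths E F. i < m \<and> (even i \<longleftrightarrow> even m)"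
    using assms(3-5) by (cases "even k \<longleftrightarrow> even m") (force, intro bexI[of _ "k + 1"], auto)
  then obtain A where A: "A \<subseteq> E" "width (twist F A) < m" "even (width (twist F A)) \<longleftrightarrow> even m"
    by (auto simp: widths)
  have "odd_exchange F"
    using odd_exchange_binary assms(1,2) by (auto simp: delta_matroid_def)
  from width_interpolation[OF assms(1) this A B] show ?thesis
    by (auto simp: widths)
qed

end
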